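(* Let $K,m\ge 1$ and let $\mathcal{D}=\{(u_k,\beta_k)\}_{k=1}^K$ be a sequence of monotone continuous utility functions $u_k:\mathbb{R}^m_+\to\mathbb{R}$ and responses $\beta_k\in\mathbb{R}^m_+$. Budget constraints are of the form $g(\beta)-\gamma_k\le 0$, i.e. one function $g$ common to all $k$ and a scalar threshold $\gamma_k$ for each $k$. Then the following statements are equivalent: (1) There exist a monotone continuous function $g:\mathbb{R}^m_+\to\mathbb{R}$ and scalars $\gamma_1,\dots,\gamma_K$ such that, with $g_k(\beta)=g(\beta)-\gamma_k$, $$\beta_k\in\operatorname{argmax}_{\beta\in\mathbb{R}^m_+}\{u_k(\beta): g_k(\beta)\le 0\}\quad\text{for every }k=1,\dots,K .$$ (2) There exist positive reals $\{\bar g_k,\lambda_k\}_{k=1}^K$ such that $$\bar g_s-\bar g_t-\lambda_t\,(u_t(\beta_s)-u_t(\beta_t))\ge 0\quad\text{for all } s,t\in\{1,\dots,K\}.$$ (3) The data set $\{(u_t(\beta_t)-u_t(\cdot),\,\beta_t)\}_{t=1}^K$ satisfies GARP. Moreover, for any positive reals $\{\bar g_k,\lambda_k\}_{k=1}^K$ satisfying the inequalities in (2), the sequence of monotone constraints $\{g(\beta)-\bar g_k\le 0\}_{k=1}^K$ with $$g(\beta)=\max_{t\in\{1,\dots,K\}}\{\bar g_t+\lambda_t\,(u_t(\beta)-u_t(\beta_t))\}$$ rationalizes $\mathcal{D}$, i.e. $\beta_k\in\operatorname{argmax}_{\beta\in\mathbb{R}^m_+}\{u_k(\beta): g(\beta)\le\bar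 g_k\}$ for every $k$.
   Context: A function $f:\mathbb{R}^m_+\to\mathbb{R}$ is monotone if $x\ge y$ componentwise implies $f(x)\ge f(y)$, with $f(x)>f(y)$ when $x_i>y_i$ for all $i$ (in particular, $f$ is locally non-satiated). GARP (Generalized Axiom of Revealed Preference): a data set $\{(h_t(\cdot),\beta_t)\}_{t=1}^K$ with $h_t:\mathbb{R}^m_+\to\mathbb{R}$ satisfies GARP if for every finite sequence of indices $t_1,\dots,t_k\in\{1,\dots,K\}$, $$h_{t_i}(\beta_{t_{i+1}})\le h_{t_i}(\beta_{t_i})\ \ \forall\, i\le k-1\quad\Longrightarrow\quad h_{t_k}(\beta_{t_1})\ge h_{t_k}(\beta_{t_k}).$$ In (3) this is applied with $h_t(\cdot)=u_t(\beta_t)-u_t(\cdot)$. *)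

theory Defs
  imports "HOL-Analysis.Analysis"
begin

text \<open>
  Functions on the nonnegative orthant are total functions on \<open>real ^ 'm\<close>; everything below
  refers to their values on \<open>orthant\<close> only.  The order on vectors is the componentwise one.
\<close>

definition orthant :: "(real ^ 'm) set" where
  "orthant = {x. 0 \<le> x}"

text \<open>
  \<open>monotone_utility\<close> is weak monotonicity plus a strict increase when all coordinates strictly
  increase.  The latter is spelled out because the strict order on vectors only asks for one strict coordinate.
\<close>

definition monotone_utility :: "(real ^ 'm \<Rightarrow> real) \<Rightarrow> bool" where
  "monotone_utility f \<longleftrightarrow>
     (\<forall>x\<in>orthant. \<forall>y\<in>orthant. y \<le> x \<longrightarrow> f y \<le> f x) \<and>
     (\<forall>x\<in>orthant. \<forall>y\<in>orthant. (\<forall>i. y $ i < x $ i) \<longrightarrow> f y < f x)"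

text \<open>
  The budget set of agent \<open>k\<close> is \<open>{b \<in> orthant. c k b \<le> 0}\<close>.
\<close>

definition rationalizes ::
    "nat \<Rightarrow> (nat \<Rightarrow> real ^ 'm \<Rightarrow> real) \<Rightarrow> (nat \<Rightarrow> real ^ 'm) \<Rightarrow> (nat \<Rightarrow> real ^ 'm \<Rightarrow> real) \<Rightarrow> bool" where
  "rationalizes K u \<beta> c \<longleftrightarrow>
     (\<forall>k\<in>{1..K}. is_arg_max (u k) (\<lambda>b. b \<in> orthant \<and> c k b \<le> 0) (\<beta> k))"

definition afriat_solution ::
    "nat \<Rightarrow> (nat \<Rightarrow> real ^ 'm \<Rightarrow> real) \<Rightarrow> (nat \<Rightarrow> real ^ 'm) \<Rightarrow> (nat \<Rightarrow> real) \<Rightarrow> (nat \<Rightarrow> real) \<Rightarrow> bool" where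
  "afriat_solution K u \<beta> gbar lam \<longleftrightarrow>
     (\<forall>k\<in>{1..K}. gbar k > 0 \<and> lam k > 0) \<and>
     (\<forall>s\<in>{1..K}. \<forall>t\<in>{1..K}. gbar s - gbar t - lam t * (u t (\<beta> s) - u t (\<beta> t)) \<ge> 0)"

text \<open>
  Finite index sequences \<open>t\<^sub>1, \<dots>, t\<^sub>k\<close> are the restrictions of \<open>\<tau>\<close> to \<open>{1..k}\<close>; repetitions are allowed.
\<close>

definition GARP ::
    "nat \<Rightarrow> (nat \<Rightarrow> real ^ 'm \<Rightarrow> real) \<Rightarrow> (nat \<Rightarrow> real ^ 'm) \<Rightarrow> bool" where
  "GARP K h \<beta> \<longleftrightarrow>
     (\<forall>k\<ge>1. \<forall>\<tau>::nat \<Rightarrow> nat. (\<forall>i\<in>{1..k}. \<tau> i \<in> {1..K}) \<longrightarrow>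
        (\<forall>i\<in>{1..<k}. h (\<tau> i) (\<beta> (\<tau> (i + 1))) \<le> h (\<tau> i) (\<beta> (\<tau> i))) \<longrightarrow>
        h (\<tau> k) (\<beta> (\<tau> 1)) \<ge> h (\<tau> k) (\<beta> (\<tau> k)))"

end

theory Submission
  imports Defs
begin

text \<open>
  For (1) to (3), write \<open>a t s = u t (\<beta> s) - u t (\<beta> t)\<close>.  If \<open>a t s \<ge> 0\<close> then
  \<open>g (\<beta> t) \<le> g (\<beta> s)\<close>, since otherwise a small increase of all coordinates of \<open>\<beta> s\<close> would be feasible
  for \<open>t\<close> and strictly better than \<open>\<beta> t\<close>; if \<open>a t s > 0\<close> the inequality is strict.  So a revealed
  preference cycle cannot contain a strict step.

  For (3) to (2), let \<open>\<rho> t\<close> count the predecessors of \<open>t\<close> under the reflexive transitive closure of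
  \<open>a t s \<ge> 0\<close>.  GARP says that \<open>\<rho>\<close> increases weakly along \<open>a t s \<ge> 0\<close> and strictly along
  \<open>a t s > 0\<close>.  Then \<open>gbar t = M ^ \<rho> t\<close> and \<open>lam t = M ^ \<rho> t / \<delta>\<close> solve the inequalities, for \<open>\<delta>\<close> a
  lower bound on the negative \<open>\<bar>a t s\<bar>\<close> and \<open>M\<close> large.
\<close>

section \<open>Solving the Afriat inequalities by ranks\<close>

lemma ranked_afriat_numbers:
  fixes a :: "'a \<Rightarrow> 'a \<Rightarrow> real" and \<rho> :: "'a \<Rightarrow> nat"
  assumes fin: "finite S"
    and weak: "\<And>s t. s \<in> S \<Longrightarrow> t \<in> S \<Longrightarrow> 0 \<le> a t s \<Longrightarrow> \<rho> t \<le> \<rho> s"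
    and strict: "\<And>s t. s \<in> S \<Longrightarrow> t \<in> S \<Longrightarrow> 0 < a t s \<Longrightarrow> \<rho> t < \<rho> s"
  obtains g lam :: "'a \<Rightarrow> real"
  where "\<And>t. g t > 0" "\<And>t. lam t > 0"
    and "\<And>s t. s \<in> S \<Longrightarrow> t \<in> S \<Longrightarrow> g s - g t - lam t * a t s \<ge> 0"
proof -
  \<comment> \<open>One finite set serves for both bounds: its minimum for the negative entries, its
    maximum for the positive ones. The extra 1 keeps it nonempty when every entry vanishes.\<close>
  define B where "B = insert 1 ((\<lambda>(t, s). \<bar>a t s\<bar>) ` {(t, s). t \<in> S \<and> s \<in> S \<and> a t s \<noteq> 0})"
  have finB: "finite B"
    unfolding B_def
    by (intro finite.insertI finite_imageI finite_subset[OF _ finite_cartesian_product[OF fin fin]]) auto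
  have posB: "b > 0" if "b \<in> B" for b
    using that by (auto simp: B_def)
  have memB: "\<bar>a t s\<bar> \<in> B" if "s \<in> S" "t \<in> S" "a t s \<noteq> 0" for s t
    using that by (force simp: B_def)
  define \<delta> where "\<delta> = Min B"
  \<comment> \<open>Chosen so that a positive entry costs \<open>lam t * a t s\<close> at most
    \<open>(M - 1) * g t\<close>, which is what a gain of one rank provides.\<close>
  define M where "M = 1 + Max B / \<delta>"
  have \<delta>: "\<delta> > 0" and ne: "B \<noteq> {}"
    using finB posB by (auto simp: \<delta>_def B_def)
  have "Max B > 0"
    using finB ne posB Max_in by blast
  then have M: "M \<ge> 1"
    using \<delta> by (simp add: M_def)
  define g where "g t = M ^ \<rho> t" for t
  define lam where "lam t = M ^ \<rho> t / \<delta>" for t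
  have gpos: "g t > 0" for t
    using M by (simp add: g_def)
  show thesis
  proof
    show "g t > 0" "lam t > 0" for t
      using gpos[of t] \<delta> by (simp_all add: lam_def g_def)
    fix s t assume st: "s \<in> S" "t \<in> S"
    consider (less) "a t s < 0" | (eq) "a t s = 0" | (greater) "a t s > 0" by linarith
    then show "g s - g t - lam t * a t s \<ge> 0"
    proof cases
      case less
      \<comment> \<open>Dividing by \<open>\<delta>\<close> in \<open>lam\<close> makes the gain at
        least \<open>g t\<close>, so positivity of \<open>g s\<close> suffices whatever the ranks
        are.\<close>
      then have "\<delta> \<le> - a t s"
        using memB[OF st] Min_le[OF finB, of "\<bar>a t s\<bar>"] by (simp add: \<delta>_def)
      then have "g t * \<delta> \<le> g t * (- a t s)"
        using gpos[of t] by (intro mult_left_mono) auto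
      then have "g t \<le> - (lam t * a t s)"
        using \<delta> by (simp add: lam_def g_def field_simps)
      then show ?thesis
        using gpos[of s] by linarith
    next
      case eq
      then have "g t \<le> g s"
        using weak[OF st] M by (simp add: g_def power_increasing)
      then show ?thesis
        using eq by simp
    next
      case greater
      then have "a t s \<le> Max B"
        using memB[OF st] Max_ge[OF finB, of "\<bar>a t s\<bar>"] by simp
      then have "a t s / \<delta> \<le> M - 1"
        using \<delta> by (simp add: M_def divide_right_mono)
      then have "g t * (a t s / \<delta>) \<le> g t * (M - 1)"
        using gpos[of t] by (intro mult_left_mono) auto
      also have "\<dots> = M ^ Suc (\<rho> t) - g t"
        by (simp add: g_def algebra_simps)
      also have "\<dots> \<le> g s - g t"
        using power_increasing[OF Suc_leI[OF strict[OF st greater]] M] by (simp add: g_def)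
      finally show ?thesis
        by (simp add: lam_def g_def)
    qed
  qed
qed

lemma afriat_numbers:
  fixes a :: "'a \<Rightarrow> 'a \<Rightarrow> real"
  assumes fin: "finite S"
    and consistent: "\<And>s t. (s, t) \<in> {(t, s). t \<in> S \<and> s \<in> S \<and> 0 \<le> a t s}\<^sup>* \<Longrightarrow>
      s \<in> S \<Longrightarrow> t \<in> S \<Longrightarrow> a t s \<le> 0"
  obtains g lam :: "'a \<Rightarrow> real"
  where "\<And>t. g t > 0" "\<And>t. lam t > 0"
    and "\<And>s t. s \<in> S \<Longrightarrow> t \<in> S \<Longrightarrow> g s - g t - lam t * a t s \<ge> 0"
proof -
  define R where "R = {(t, s). t \<in> S \<and> s \<in> S \<and> 0 \<le> a t s}"
  define pred where "pred t = {r \<in> S. (r, t) \<in> R\<^sup>*}" for t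
  have finp: "finite (pred t)" for t
    using fin by (simp add: pred_def)
  have sub: "pred t \<subseteq> pred s" if "s \<in> S" "t \<in> S" "0 \<le> a t s" for s t
    using that by (auto simp: pred_def R_def intro: rtrancl_into_rtrancl)
  have psub: "pred t \<subset> pred s" if "s \<in> S" "t \<in> S" "0 < a t s" for s t
  proof -
    have "s \<in> pred s"
      using that by (simp add: pred_def)
    \<comment> \<open>A path from \<open>s\<close> to \<open>t\<close>, closed by the strict step
      from \<open>t\<close> to \<open>s\<close>, would contradict \<open>consistent\<close>.\<close>
    moreover have "s \<notin> pred t"
      using consistent[of s t] that by (auto simp: pred_def R_def)
    ultimately show ?thesis
      using sub[of s t] that by auto
  qed
  show thesis
    by (rule ranked_afriat_numbers[OF fin card_mono[OF finp sub] psubset_card_mono[OF finp psub]])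
      (assumption | rule that)+
qed

section \<open>GARP as a condition on paths\<close>

lemma GARP_cycle:
  assumes "GARP K h \<beta>"
    and path: "(s, t) \<in> {(t, s). t \<in> {1..K} \<and> s \<in> {1..K} \<and> h t (\<beta> s) \<le> h t (\<beta> t)}\<^sup>*"
    and s: "s \<in> {1..K}"
  shows "h t (\<beta> t) \<le> h t (\<beta> s)"
proof -
  define R where "R = {(t, s). t \<in> {1..K} \<and> s \<in> {1..K} \<and> h t (\<beta> s) \<le> h t (\<beta> t)}"
  obtain n where "(s, t) \<in> R ^^ n"
    using path rtrancl_imp_relpow unfolding R_def by blast
  then obtain f where f: "f 0 = s" "f n = t" "\<And>i. i < n \<Longrightarrow> (f i, f (Suc i)) \<in> R"
    by (auto simp: relpow_fun_conv)
  \<comment> \<open>Since the path may be empty, \<open>f 0\<close> relies on the hypothesis on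
    \<open>s\<close>; every later point is the target of an edge.\<close>
  have mem: "f i \<in> {1..K}" if "i \<le> n" for i
    using that s f(1) f(3)[of "i - 1"] by (cases i) (auto simp: R_def)
  have step: "h (f (i - 1)) (\<beta> (f i)) \<le> h (f (i - 1)) (\<beta> (f (i - 1)))" if "i \<in> {1..n}" for i
    using that f(3)[of "i - 1"] by (auto simp: R_def)
  \<comment> \<open>A path with \<open>n\<close> edges visits \<open>Suc n\<close> points, numbered
    from 0; GARP numbers from 1, hence the shift by one.\<close>
  have "\<forall>i\<in>{1..Suc n}. f (i - 1) \<in> {1..K}"
    by (intro ballI mem) auto
  moreover have "\<forall>i\<in>{1..<Suc n}. h (f (i - 1)) (\<beta> (f (i + 1 - 1))) \<le> h (f (i - 1)) (\<beta> (f (i - 1)))"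
    using step by auto
  ultimately have "h (f (Suc n - 1)) (\<beta> (f (Suc n - 1))) \<le> h (f (Suc n - 1)) (\<beta> (f (1 - 1)))"
    using assms(1)[unfolded GARP_def, rule_format, of "Suc n" "\<lambda>i. f (i - 1)"] by auto
  then show ?thesis
    using f by simp
qed

text \<open>For this data set, \<open>h t (\<beta> s) \<le> h t (\<beta> t)\<close> amounts to
  \<open>0 \<le> a t s\<close>, so \<open>GARP_cycle\<close> supplies the hypothesis
  \<open>consistent\<close> of \<open>afriat_numbers\<close>.\<close>

lemma GARP_imp_afriat_solution:
  assumes "GARP K (\<lambda>t b. u t (\<beta> t) - u t b) \<beta>"
  shows "\<exists>gbar lam. afriat_solution K u \<beta> gbar lam"
proof -
  define a where "a t s = u t (\<beta> s) - u t (\<beta> t)" for t s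
  have "a t s \<le> 0"
    if "(s, t) \<in> {(t, s). t \<in> {1..K} \<and> s \<in> {1..K} \<and> 0 \<le> a t s}\<^sup>*" "s \<in> {1..K}" for s t
    using GARP_cycle[OF assms, of s t] that by (simp add: a_def)
  then obtain g lam :: "nat \<Rightarrow> real" where "\<And>t. g t > 0" "\<And>t. lam t > 0"
    "\<And>s t. s \<in> {1..K} \<Longrightarrow> t \<in> {1..K} \<Longrightarrow> g s - g t - lam t * a t s \<ge> 0"
    by (rule afriat_numbers[OF finite_atLeastAtMost[of 1 K], of a]) (assumption | rule that)+
  then show ?thesis
    unfolding afriat_solution_def a_def by blast
qed

section \<open>From a common constraint to GARP\<close>

lemma locally_nonsatiated:
  fixes f :: "real ^ 'm \<Rightarrow> real" and g :: "real ^ 'm \<Rightarrow> 'b::order_topology"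
  assumes g: "continuous_on orthant g" and f: "monotone_utility f"
    and x: "x \<in> orthant" "g x < c"
  obtains y where "y \<in> orthant" "g y < c" "f x < f y"
proof -
  \<comment> \<open>Moving along the diagonal raises all coordinates at once, as the strict clause
    of monotonicity demands. Only \<open>e \<ge> 0\<close> is sure to stay in the orthant, so the
    limit at 0 is one-sided.\<close>
  define p :: "real \<Rightarrow> real ^ 'm" where "p e = x + (\<chi> i. e)" for e
  have orth: "p e \<in> orthant" if "e \<ge> 0" for e
    using x that by (auto simp: p_def orthant_def less_eq_vec_def)
  have "continuous_on {0..} p"
    unfolding p_def by (intro continuous_intros)
  then have "continuous_on {0..} (g \<circ> p)"
    using orth by (intro continuous_on_compose continuous_on_subset[OF g]) auto
  then have "((g \<circ> p) \<longlongrightarrow> (g \<circ> p) 0) (at 0 within {0..})"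
    unfolding continuous_on_def by (rule bspec) simp
  moreover have "p 0 = x"
    by (simp add: p_def vec_eq_iff)
  ultimately have "\<forall>\<^sub>F e in at 0 within {0..}. g (p e) < c"
    using order_tendstoD(2)[of "g \<circ> p" _ _ c] x(2) by simp
  then obtain d where d: "d > 0" "\<And>e. e \<ge> 0 \<Longrightarrow> e \<noteq> 0 \<Longrightarrow> dist e 0 < d \<Longrightarrow> g (p e) < c"
    by (auto simp: eventually_at)
  show thesis
  proof
    show "p (d / 2) \<in> orthant" "g (p (d / 2)) < c"
      using d by (auto intro: orth d(2))
    then show "f x < f (p (d / 2))"
      using f x(1) d(1) by (auto simp: monotone_utility_def p_def)
  qed
qed

text \<open>Weak steps push \<open>g\<close> upwards along the sequence, so its first response is
  affordable for its last agent. Optimality of that agent's own response is then the conclusion of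
  GARP.\<close>

lemma rationalizes_imp_GARP:
  assumes u: "\<And>k. k \<in> {1..K} \<Longrightarrow> monotone_utility (u k)"
    and \<beta>: "\<And>k. k \<in> {1..K} \<Longrightarrow> \<beta> k \<in> orthant"
    and g: "continuous_on orthant g"
    and rat: "rationalizes K u \<beta> (\<lambda>k b. g b - \<gamma> k)"
  shows "GARP K (\<lambda>t b. u t (\<beta> t) - u t b) \<beta>"
proof -
  have feas: "g (\<beta> t) \<le> \<gamma> t" if "t \<in> {1..K}" for t
    using rat that by (auto simp: rationalizes_def is_arg_max_def)
  have opt: "u t b \<le> u t (\<beta> t)" if "t \<in> {1..K}" "b \<in> orthant" "g b \<le> \<gamma> t" for t b
    using rat that unfolding rationalizes_def is_arg_max_def by fastforce
  have weak: "g (\<beta> t) \<le> g (\<beta> s)"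
    if ts: "t \<in> {1..K}" "s \<in> {1..K}" "u t (\<beta> t) \<le> u t (\<beta> s)" for t s
  proof (rule ccontr)
    assume "\<not> g (\<beta> t) \<le> g (\<beta> s)"
    \<comment> \<open>The budget of \<open>t\<close> need not bind, but strict slack at
      \<open>\<beta> s\<close> is enough for a feasible improvement.\<close>
    then have "g (\<beta> s) < \<gamma> t"
      using feas[OF ts(1)] by linarith
    then obtain y where "y \<in> orthant" "g y < \<gamma> t" "u t (\<beta> s) < u t y"
      using locally_nonsatiated[OF g u[OF ts(1)] \<beta>[OF ts(2)]] by blast
    then show False
      using opt[of t y] ts by linarith
  qed
  show ?thesis
    unfolding GARP_def
  proof (intro allI impI)
    fix k :: nat and \<tau> :: "nat \<Rightarrow> nat"
    assume k: "1 \<le> k" and \<tau>: "\<forall>i\<in>{1..k}. \<tau> i \<in> {1..K}"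
      and step: "\<forall>i\<in>{1..<k}. u (\<tau> i) (\<beta> (\<tau> i)) - u (\<tau> i) (\<beta> (\<tau> (i + 1)))
        \<le> u (\<tau> i) (\<beta> (\<tau> i)) - u (\<tau> i) (\<beta> (\<tau> i))"
    have chain: "g (\<beta> (\<tau> 1)) \<le> g (\<beta> (\<tau> j))" if "1 \<le> j" "j \<le> k" for j
      using that
    proof (induction j rule: dec_induct)
      case (step j)
      have "g (\<beta> (\<tau> j)) \<le> g (\<beta> (\<tau> (Suc j)))"
        using step \<tau> \<open>\<forall>i\<in>{1..<k}. _ i\<close> by (intro weak) auto
      then show ?case
        using step by simp
    qed simp
    have "\<tau> 1 \<in> {1..K}" "\<tau> k \<in> {1..K}"
      using k \<tau> by auto
    moreover have "g (\<beta> (\<tau> 1)) \<le> \<gamma> (\<tau> k)"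
      using chain[of k] k feas[of "\<tau> k"] calculation by linarith
    ultimately show "u (\<tau> k) (\<beta> (\<tau> k)) - u (\<tau> k) (\<beta> (\<tau> k))
        \<le> u (\<tau> k) (\<beta> (\<tau> k)) - u (\<tau> k) (\<beta> (\<tau> 1))"
      using opt[of "\<tau> k" "\<beta> (\<tau> 1)"] \<beta> by simp
  qed
qed

section \<open>The explicit maximum as a constraint\<close>

lemma monotone_utility_affine:
  assumes "monotone_utility f" "0 < (c::real)"
  shows "monotone_utility (\<lambda>b. d + c * (f b - e))"
  using assms by (simp add: monotone_utility_def)

lemma monotone_utility_MAX:
  assumes S: "finite S" "S \<noteq> {}" and f: "\<And>t. t \<in> S \<Longrightarrow> monotone_utility (f t)"
  shows "monotone_utility (\<lambda>b. MAX t\<in>S. f t b)"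
proof -
  have attained: "\<exists>t\<in>S. (MAX t\<in>S. f t b) = f t b" for b
    using Max_in[of "(\<lambda>t. f t b) ` S"] S by (auto simp del: Max_in)
  have upper: "f t b \<le> (MAX t\<in>S. f t b)" if "t \<in> S" for t b
    using S that by simp
  have "(MAX t\<in>S. f t y) \<le> (MAX t\<in>S. f t x)"
    if "x \<in> orthant" "y \<in> orthant" "y \<le> x" for x y
  proof -
    \<comment> \<open>The index attaining the maximum at \<open>y\<close> stays a competitor at
      \<open>x\<close>, so its own monotonicity passes to the maximum.\<close>
    obtain t where t: "t \<in> S" "(MAX t\<in>S. f t y) = f t y"
      using attained by blast
    then have "f t y \<le> f t x"
      using f that by (simp add: monotone_utility_def)
    then show ?thesis
      using t upper[of t x] by linarith
  qed
  moreover have "(MAX t\<in>S. f t y) < (MAX t\<in>S. f t x)"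
    if "x \<in> orthant" "y \<in> orthant" "\<forall>i. y $ i < x $ i" for x y
  proof -
    obtain t where t: "t \<in> S" "(MAX t\<in>S. f t y) = f t y"
      using attained by blast
    then have "f t y < f t x"
      using f that by (simp add: monotone_utility_def)
    then show ?thesis
      using t upper[of t x] by linarith
  qed
  ultimately show ?thesis
    unfolding monotone_utility_def by blast
qed

lemma continuous_on_MAX:
  fixes f :: "'a \<Rightarrow> 'b::topological_space \<Rightarrow> 'c::linorder_topology"
  assumes "finite S" "S \<noteq> {}" "\<And>t. t \<in> S \<Longrightarrow> continuous_on A (f t)"
  shows "continuous_on A (\<lambda>b. MAX t\<in>S. f t b)"
  using assms
proof (induction S rule: finite_ne_induct)
  case (insert x F)
  then show ?case
    by (simp add: continuous_on_max)
qed simp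

lemma afriat_solution_rationalizes:
  assumes sol: "afriat_solution K u \<beta> gbar lam"
    and \<beta>: "\<And>k. k \<in> {1..K} \<Longrightarrow> \<beta> k \<in> orthant"
  shows "rationalizes K u \<beta> (\<lambda>k b. (MAX t\<in>{1..K}. gbar t + lam t * (u t b - u t (\<beta> t))) - gbar k)"
  unfolding rationalizes_def is_arg_max_def
proof (intro ballI conjI notI)
  fix k assume k: "k \<in> {1..K}"
  then have ne: "{1..K} \<noteq> {}" by auto
  show "\<beta> k \<in> orthant"
    using \<beta> k .
  \<comment> \<open>Feasibility of \<open>\<beta> k\<close> is the family of Afriat inequalities
    with \<open>s = k\<close>.\<close>
  have "gbar t + lam t * (u t (\<beta> k) - u t (\<beta> t)) \<le> gbar k" if "t \<in> {1..K}" for t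
    using sol that k by (force simp: afriat_solution_def)
  then show "(MAX t\<in>{1..K}. gbar t + lam t * (u t (\<beta> k) - u t (\<beta> t))) - gbar k \<le> 0"
    using ne by simp
  assume "\<exists>y. (y \<in> orthant \<and>
    (MAX t\<in>{1..K}. gbar t + lam t * (u t y - u t (\<beta> t))) - gbar k \<le> 0) \<and> u k (\<beta> k) < u k y"
  then obtain y where y: "(MAX t\<in>{1..K}. gbar t + lam t * (u t y - u t (\<beta> t))) \<le> gbar k"
    "u k (\<beta> k) < u k y" by auto
  \<comment> \<open>The term \<open>t = k\<close> of the maximum alone excludes any feasible
    improvement for \<open>k\<close>.\<close>
  have "gbar k + lam k * (u k y - u k (\<beta> k)) \<le> gbar k"
    using k by (intro order_trans[OF Max_ge y(1)]) auto
  moreover have "lam k > 0"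
    using sol k by (simp add: afriat_solution_def)
  ultimately show False
    using y(2) by (simp add: mult_le_0_iff)
qed

theorem theorem2:
  fixes K :: nat
    and u :: "nat \<Rightarrow> real ^ 'm \<Rightarrow> real"
    and \<beta> :: "nat \<Rightarrow> real ^ 'm"
  assumes "K \<ge> 1"
    and "\<And>k. k \<in> {1..K} \<Longrightarrow> monotone_utility (u k)"
    and "\<And>k. k \<in> {1..K} \<Longrightarrow> continuous_on orthant (u k)"
    and "\<And>k. k \<in> {1..K} \<Longrightarrow> \<beta> k \<in> orthant"
  shows "((\<exists>g \<gamma>. monotone_utility g \<and> continuous_on orthant g \<and>
             rationalizes K u \<beta> (\<lambda>k b. g b - \<gamma> k))
           \<longleftrightarrow> (\<exists>gbar lam. afriat_solution K u \<beta> gbar lam))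
    \<and> ((\<exists>gbar lam. afriat_solution K u \<beta> gbar lam)
           \<longleftrightarrow> GARP K (\<lambda>t b. u t (\<beta> t) - u t b) \<beta>)
    \<and> (\<forall>gbar lam. afriat_solution K u \<beta> gbar lam \<longrightarrow>
         (let g = (\<lambda>b. MAX t\<in>{1..K}. gbar t + lam t * (u t b - u t (\<beta> t)))
          in (\<forall>k\<in>{1..K}. monotone_utility (\<lambda>b. g b - gbar k)) \<and>
             rationalizes K u \<beta> (\<lambda>k b. g b - gbar k)))"
proof -
  let ?g = "\<lambda>gbar lam b. MAX t\<in>{1..K}. gbar t + lam t * (u t b - u t (\<beta> t))"
  have ne: "{1..K} \<noteq> {}"
    using assms(1) by simp
  have mono: "monotone_utility (?g gbar lam)" if "afriat_solution K u \<beta> gbar lam" for gbar lam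
    using that assms(2) ne
    by (intro monotone_utility_MAX monotone_utility_affine) (auto simp: afriat_solution_def)
  have cont: "continuous_on orthant (?g gbar lam)" for gbar lam
    using assms(3) ne by (intro continuous_on_MAX continuous_intros) auto
  have rat: "rationalizes K u \<beta> (\<lambda>k b. ?g gbar lam b - gbar k)"
    if "afriat_solution K u \<beta> gbar lam" for gbar lam
    using afriat_solution_rationalizes[OF that assms(4)] .
  have 1: "\<exists>g \<gamma>. monotone_utility g \<and> continuous_on orthant g \<and>
      rationalizes K u \<beta> (\<lambda>k b. g b - \<gamma> k)" if "afriat_solution K u \<beta> gbar lam" for gbar lam
    \<comment> \<open>The numbers \<open>gbar\<close> themselves serve as thresholds.\<close>
    using mono[OF that] cont rat[OF that] by blast
  have 2: "GARP K (\<lambda>t b. u t (\<beta> t) - u t b) \<beta>"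
    if "continuous_on orthant g" "rationalizes K u \<beta> (\<lambda>k b. g b - \<gamma> k)" for g \<gamma>
    using rationalizes_imp_GARP[OF assms(2,4) that] .
  have "monotone_utility (\<lambda>b. ?g gbar lam b - gbar k)"
    if "afriat_solution K u \<beta> gbar lam" for gbar lam k
    using mono[OF that] by (simp add: monotone_utility_def)
  with rat have 3: "\<forall>gbar lam. afriat_solution K u \<beta> gbar lam \<longrightarrow>
      (let g = ?g gbar lam
       in (\<forall>k\<in>{1..K}. monotone_utility (\<lambda>b. g b - gbar k)) \<and>
          rationalizes K u \<beta> (\<lambda>k b. g b - gbar k))"
    unfolding Let_def by blast
  show ?thesis
    \<comment> \<open>Both equivalences follow from the cycle (2) to (1) to (3) to (2).\<close>
    by (intro conjI 3) (use 1 2 GARP_imp_afriat_solution[of K u \<beta>] in blast)+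
qed

end
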